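(* Fix a rooted tree $B$ with at least one edge. For $g\ge3$ let $G_g$ be the localized single-vertex defect: the cycle $C_g$ with $B$ attached (by its root) at a single cycle vertex $v_0$, every other cycle vertex having degree $2$. Then the limit $$\lambda_\infty:=\lim_{g\to\infty}\lambda_{\max}(R_{G_g})$$ exists and is strictly positive.
   Context: Ricci matrix: for a finite connected simple graph $G=(V,E)$ with degrees $d_v$, $R_G\in\mathbb{R}^{E\times E}$ has diagonal entries $-(1/d_x+1/d_y)$ for $e=\{x,y\}$, entry $1/d_z$ for $e\ne e'$ with $e\cap e'=\{z\}$, and $0$ for disjoint edges; $\lambda_{\max}(R_G)$ is its largest eigenvalue. *)

theory Defs
  imports
    "HOL-Library.Countable_Set"
    "Jordan_Normal_Form.Spectral_Radius"
begin

section \<open>Finite simple graphs and rooted trees\<close>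

record 'a sgraph =
  gverts :: "'a set"
  gedges :: "'a set set"

definition simple_graph :: "'a sgraph \<Rightarrow> bool" where
  "simple_graph G \<longleftrightarrow> finite (gverts G) \<and>
     (\<forall>e\<in>gedges G. \<exists>x\<in>gverts G. \<exists>y\<in>gverts G. x \<noteq> y \<and> e = {x, y})"

definition vdegree :: "'a sgraph \<Rightarrow> 'a \<Rightarrow> nat" where
  "vdegree G v = card {e \<in> gedges G. v \<in> e}"

definition connected_graph :: "'a sgraph \<Rightarrow> bool" where
  "connected_graph G \<longleftrightarrow> gverts G \<noteq> {} \<and>
     (\<forall>u\<in>gverts G. \<forall>v\<in>gverts G. (u, v) \<in> {(x, y). {x, y} \<in> gedges G}\<^sup>*)"

definition is_cycle :: "'a sgraph \<Rightarrow> 'a list \<Rightarrow> bool" where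
  "is_cycle G vs \<longleftrightarrow> length vs \<ge> 3 \<and> distinct vs \<and>
     (\<forall>i<length vs. {vs ! i, vs ! (Suc i mod length vs)} \<in> gedges G)"

definition is_tree :: "'a sgraph \<Rightarrow> bool" where
  "is_tree G \<longleftrightarrow> simple_graph G \<and> connected_graph G \<and> \<not> (\<exists>vs. is_cycle G vs)"

definition rooted_tree :: "'a sgraph \<Rightarrow> 'a \<Rightarrow> bool" where
  "rooted_tree B r \<longleftrightarrow> is_tree B \<and> r \<in> gverts B"


section \<open>Attaching a rooted tree to a cycle\<close>

text \<open>The cycle is a simple graph of length \<open>g\<close> only for \<open>g \<ge> 3\<close>.\<close>

definition cycle_graph :: "nat \<Rightarrow> nat sgraph" where
  "cycle_graph g = \<lparr> gverts = {..<g}, gedges = {{i, Suc i mod g} | i. i < g} \<rparr>"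

text \<open>Disjoint union of \<open>H\<close> and \<open>B\<close> with the root \<open>r\<close> of \<open>B\<close> identified with the vertex \<open>v\<close>
  of \<open>H\<close>.\<close>

definition glue_vertex :: "'b \<Rightarrow> 'a \<Rightarrow> 'a \<Rightarrow> 'b + 'a" where
  "glue_vertex v r b = (if b = r then Inl v else Inr b)"

definition attach :: "'b sgraph \<Rightarrow> 'b \<Rightarrow> 'a sgraph \<Rightarrow> 'a \<Rightarrow> ('b + 'a) sgraph" where
  "attach H v B r =
     \<lparr> gverts = Inl ` gverts H \<union> glue_vertex v r ` gverts B,
       gedges = (\<lambda>e. Inl ` e) ` gedges H \<union> (\<lambda>e. glue_vertex v r ` e) ` gedges B \<rparr>"

definition single_defect_graph :: "nat \<Rightarrow> 'a sgraph \<Rightarrow> 'a \<Rightarrow> (nat + 'a) sgraph" where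
  "single_defect_graph g B r = attach (cycle_graph g) 0 B r"


section \<open>The Ricci matrix\<close>

text \<open>Two distinct edges of a simple graph share at most one vertex, so the second sum below is
  \<open>1 / d\<^sub>z\<close> if \<open>e \<inter> e' = {z}\<close> and \<open>0\<close> if the edges are disjoint.\<close>

definition ricci_entry :: "'a sgraph \<Rightarrow> 'a set \<Rightarrow> 'a set \<Rightarrow> real" where
  "ricci_entry G e e' =
     (if e = e' then - (\<Sum>x\<in>e. 1 / real (vdegree G x))
      else (\<Sum>z\<in>e \<inter> e'. 1 / real (vdegree G z)))"

text \<open>The library's matrices are indexed by initial segments of the naturals, so the edges are
  enumerated by \<^const>\<open>from_nat_into\<close>, a bijection from \<open>{..<card E}\<close> onto the finite edge set
  \<open>E\<close>. The spectrum does not depend on the enumeration; see \<open>eigenvalue_ricci_matrix_iff\<close>.\<close>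

definition ricci_matrix :: "'a sgraph \<Rightarrow> real mat" where
  "ricci_matrix G = mat (card (gedges G)) (card (gedges G))
     (\<lambda>(i, j). ricci_entry G (from_nat_into (gedges G) i) (from_nat_into (gedges G) j))"

text \<open>Used for real symmetric matrices of positive dimension, whose spectrum is finite and
  nonempty.\<close>

definition lambda_max :: "real mat \<Rightarrow> real" where
  "lambda_max A = Max (spectrum A)"

lemma ricci_entry_sym: "ricci_entry G e e' = ricci_entry G e' e"
  by (simp add: ricci_entry_def Int_commute)

lemma eigenvalue_ricci_matrix_iff:
  assumes fin: "finite (gedges G)"
  shows "eigenvalue (ricci_matrix G) k \<longleftrightarrow>
    (\<exists>f. (\<exists>e\<in>gedges G. f e \<noteq> 0) \<and>
         (\<forall>e\<in>gedges G. (\<Sum>e'\<in>gedges G. ricci_entry G e e' * f e') = k * f e))"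
    (is "_ \<longleftrightarrow> ?R")
proof -
  define E where "E = gedges G"
  define n where "n = card E"
  define h where "h = from_nat_into E"
  have bij: "bij_betw h {..<n} E"
    unfolding h_def n_def using fin E_def by (simp add: bij_betw_from_nat_into_finite)
  have img: "h ` {..<n} = E" using bij by (simp add: bij_betw_def)
  have dim: "dim_row (ricci_matrix G) = n" "dim_col (ricci_matrix G) = n"
    by (simp_all add: ricci_matrix_def n_def E_def)
  have row: "(ricci_matrix G *\<^sub>v v) $ i = (\<Sum>j<n. ricci_entry G (h i) (h j) * v $ j)"
    if "v \<in> carrier_vec n" "i < n" for v i
    using that by (simp add: ricci_matrix_def mult_mat_vec_def scalar_prod_def
        n_def [symmetric] E_def [symmetric] h_def [symmetric] atLeast0LessThan)
  have reidx: "(\<Sum>e'\<in>E. F e') = (\<Sum>j<n. F (h j))" for F :: "'a set \<Rightarrow> real"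
    by (rule sum.reindex_bij_betw [OF bij, symmetric])
  show ?thesis
  proof
    assume "eigenvalue (ricci_matrix G) k"
    then obtain v where v: "v \<in> carrier_vec n" "v \<noteq> 0\<^sub>v n" "ricci_matrix G *\<^sub>v v = k \<cdot>\<^sub>v v"
      unfolding eigenvalue_def eigenvector_def dim by blast
    define f where "f e = v $ (the_inv_into {..<n} h e)" for e
    have fh: "f (h i) = v $ i" if "i < n" for i
      using that bij by (simp add: f_def bij_betw_def the_inv_into_f_f)
    obtain i where i: "i < n" "v $ i \<noteq> 0"
      using v(1,2) by (metis carrier_vecD eq_vecI index_zero_vec(1) index_zero_vec(2))
    have "\<exists>e\<in>E. f e \<noteq> 0" using i fh img by auto
    moreover have "(\<Sum>e'\<in>E. ricci_entry G e e' * f e') = k * f e" if "e \<in> E" for e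
    proof -
      obtain i where i: "i < n" "e = h i" using \<open>e \<in> E\<close> img by auto
      have "(\<Sum>j<n. ricci_entry G (h i) (h j) * v $ j) = k * v $ i"
        using row [OF v(1) i(1)] v(1,3) i(1) by simp
      then show ?thesis using i by (simp add: reidx fh)
    qed
    ultimately show ?R unfolding E_def by blast
  next
    assume ?R
    then obtain f where nz: "\<exists>e\<in>E. f e \<noteq> 0"
      and ev: "\<forall>e\<in>E. (\<Sum>e'\<in>E. ricci_entry G e e' * f e') = k * f e"
      unfolding E_def by blast
    define v where "v = vec n (\<lambda>i. f (h i))"
    have vc: "v \<in> carrier_vec n" by (simp add: v_def)
    obtain i where "i < n" "f (h i) \<noteq> 0" using nz img by auto
    then have "v \<noteq> 0\<^sub>v n" by (metis index_vec index_zero_vec(1) v_def)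
    moreover have "ricci_matrix G *\<^sub>v v = k \<cdot>\<^sub>v v"
    proof (rule eq_vecI)
      fix i assume "i < dim_vec (k \<cdot>\<^sub>v v)"
      then have i: "i < n" by (simp add: v_def)
      then have "h i \<in> E" using img by auto
      with ev have "(\<Sum>j<n. ricci_entry G (h i) (h j) * f (h j)) = k * f (h i)"
        by (simp add: reidx)
      then show "(ricci_matrix G *\<^sub>v v) $ i = (k \<cdot>\<^sub>v v) $ i"
        using row [OF vc i] i by (simp add: v_def)
    qed (simp add: dim v_def)
    ultimately show "eigenvalue (ricci_matrix G) k"
      unfolding eigenvalue_def eigenvector_def dim using vc by blast
  qed
qed

end

theory Submission
  imports Defs "HOL-Analysis.Function_Topology" "HOL-Analysis.Convex"
begin

text \<open>
  As a quadratic form, \<open>R\<^sub>G\<close> is a sum over the vertices \<open>z\<close> of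
  \<open>((\<Sum>e\<ni>z. f e)\<^sup>2 - 2 (\<Sum>e\<ni>z. (f e)\<^sup>2)) / d\<^sub>z\<close>; each summand is at most \<open>\<Sum>e\<ni>z. (f e)\<^sup>2\<close>, so
  \<open>\<lambda>\<^sub>m\<^sub>a\<^sub>x \<le> 2\<close>, and a vertex of degree 2 with edge values \<open>x, y\<close> contributes \<open>-(x - y)\<^sup>2 / 2\<close>. A unit
  top eigenvector on \<open>G\<^sub>g\<close> has two consecutive cycle edges with \<open>x y \<le> 1 / (g - 1)\<close>; inserting
  \<open>h - g\<close> edges of value \<open>0\<close> between them keeps the norm and costs only \<open>x y\<close>, so
  \<open>\<lambda>\<^sub>h \<ge> \<lambda>\<^sub>g - 1 / (g - 1)\<close> for all \<open>h \<ge> g\<close>. A bounded sequence with this property converges. The limit is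
  positive because a fixed finitely supported test function, \<open>1\<close> on \<open>B\<close> and decaying linearly from \<open>2\<close>
  along the cycle, has a positive form on every large \<open>G\<^sub>g\<close>.
\<close>

subsection \<open>The Ricci matrix as a quadratic form\<close>

text \<open>A maximizer of the form on the unit sphere exists by compactness, and vanishing of the
  first variation makes it an eigenvector. Vectors are plain functions on the index type, so only
  their values on \<open>E\<close> matter.\<close>

lemma symmetric_form_maximizer:
  fixes M :: "'e \<Rightarrow> 'e \<Rightarrow> real"
  assumes fin: "finite E" and ne: "E \<noteq> {}"
    and sym: "\<And>e e'. M e e' = M e' e"
  obtains lam f where "(\<Sum>e\<in>E. (f e)\<^sup>2) = 1"
    "\<And>e. e \<in> E \<Longrightarrow> (\<Sum>e'\<in>E. M e e' * f e') = lam * f e"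
    "\<And>g. (\<Sum>e\<in>E. \<Sum>e'\<in>E. M e e' * g e * g e') \<le> lam * (\<Sum>e\<in>E. (g e)\<^sup>2)"
proof -
  define N where "N g = (\<Sum>e\<in>E. (g e)\<^sup>2)" for g :: "'e \<Rightarrow> real"
  define Q where "Q g = (\<Sum>e\<in>E. \<Sum>e'\<in>E. M e e' * g e * g e')" for g
  \<comment> \<open>The sphere \<open>N g = 1\<close> leaves the values outside \<open>E\<close>
    free. \<open>K\<close> pins them to 0 and boxes the others, so it is compact by Tychonoff and
    contains every unit vector supported on \<open>E\<close>.\<close>
  define K :: "('e \<Rightarrow> real) set" where "K = PiE UNIV (\<lambda>e. if e \<in> E then {-1..1} else {0})"
  have contN: "continuous_on UNIV N" and contQ: "continuous_on UNIV Q"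
    unfolding N_def [abs_def] Q_def [abs_def] by (intro continuous_intros; simp)+
  have "compactin (product_topology (\<lambda>_::'e. euclidean::real topology) UNIV) K"
    unfolding K_def compactin_PiE by simp
  then have "compact K"
    unfolding euclidean_product_topology by simp
  moreover have "closed {g. N g = 1}"
    using closed_Collect_eq [OF contN continuous_on_const] by simp
  ultimately have comp: "compact (K \<inter> {g. N g = 1})"
    by (rule compact_Int_closed)
  obtain e0 where e0: "e0 \<in> E" using ne by blast
  have "N (\<lambda>e. if e = e0 then 1 else 0) = (\<Sum>e\<in>E. if e = e0 then 1 else 0)"
    unfolding N_def by (rule sum.cong) auto
  then have "(\<lambda>e. if e = e0 then 1 else 0) \<in> K \<inter> {g. N g = 1}"
    using e0 fin by (auto simp: K_def PiE_def)
  then have "K \<inter> {g. N g = 1} \<noteq> {}" by blast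
  from continuous_attains_sup [OF comp this continuous_on_subset [OF contQ subset_UNIV]]
  obtain f where f: "N f = 1" and max: "\<And>g. g \<in> K \<Longrightarrow> N g = 1 \<Longrightarrow> Q g \<le> Q f"
    by blast
  define lam where "lam = Q f"
  have bound: "Q g \<le> lam * N g" for g
  proof (cases "N g = 0")
    case True
    then have "\<forall>e\<in>E. g e = 0" using fin by (simp add: N_def sum_nonneg_eq_0_iff)
    then show ?thesis using True by (simp add: Q_def)
  next
    case False
    moreover have "N g \<ge> 0" by (simp add: N_def sum_nonneg)
    ultimately have pos: "N g > 0" by simp
    define c where "c = 1 / sqrt (N g)"
    have c2: "c\<^sup>2 * N g = 1" using pos by (simp add: c_def power_divide)
    define h where "h e = (if e \<in> E then c * g e else 0)" for e
    have Nh: "N h = c\<^sup>2 * N g"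
      by (simp add: N_def h_def power_mult_distrib sum_distrib_left)
    have Qh: "Q h = c\<^sup>2 * Q g"
      by (simp add: Q_def h_def sum_distrib_left power2_eq_square mult_ac)
    have "\<bar>h e\<bar> \<le> 1" if "e \<in> E" for e
    proof -
      have "(h e)\<^sup>2 \<le> N h" unfolding N_def
        using that fin by (intro member_le_sum) auto
      then show ?thesis using Nh c2 by (simp add: abs_square_le_1)
    qed
    then have "h \<in> K" unfolding K_def by (auto simp: PiE_def h_def abs_le_iff)
    then have "c\<^sup>2 * Q g \<le> lam * (c\<^sup>2 * N g)"
      using max [of h] Nh c2 by (simp add: Qh lam_def)
    moreover have "c\<^sup>2 > 0" using pos by (simp add: c_def)
    ultimately show ?thesis
      by (metis mult.left_commute mult_le_cancel_left_pos)
  qed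
  have eig: "(\<Sum>e'\<in>E. M e e' * f e') = lam * f e" if e: "e \<in> E" for e
  proof -
    define D where "D = lam * f e - (\<Sum>e'\<in>E. M e e' * f e')"
    define p where "p e' = (if e' = e then 1 else 0 :: real)" for e'
    define C where "C = lam - M e e"
    \<comment> \<open>Perturb \<open>f\<close> by \<open>t\<close> in the coordinate
      \<open>e\<close>: \<open>lam * N - Q\<close> is nonnegative and vanishes at
      \<open>t = 0\<close>, so its linear coefficient \<open>2 * D\<close> must be 0.\<close>
    have "0 \<le> 2 * t * D + t\<^sup>2 * C" for t
    proof -
      have "N (\<lambda>e'. f e' + t * p e')
          = (\<Sum>e'\<in>E. (f e')\<^sup>2 + ((2 * t * f e') * p e' + t\<^sup>2 * p e'))"
        unfolding N_def by (rule sum.cong) (auto simp: p_def power2_sum)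
      also have "\<dots> = N f + 2 * t * f e + t\<^sup>2"
        using e fin by (simp add: sum.distrib N_def p_def if_distrib [of "\<lambda>x. _ * x"] cong: if_cong)
      finally have 1: "N (\<lambda>e'. f e' + t * p e') = N f + 2 * t * f e + t\<^sup>2" .
      have "Q (\<lambda>e'. f e' + t * p e') = Q f + t * (\<Sum>a\<in>E. \<Sum>b\<in>E. M a b * f a * p b)
          + t * (\<Sum>a\<in>E. \<Sum>b\<in>E. M a b * f b * p a)
          + t\<^sup>2 * (\<Sum>a\<in>E. \<Sum>b\<in>E. M a b * p b * p a)"
      proof -
        have "M a b * (f a + t * p a) * (f b + t * p b) = M a b * f a * f b
            + t * (M a b * f a * p b) + t * (M a b * f b * p a) + t\<^sup>2 * (M a b * p b * p a)" for a b
          by (simp add: algebra_simps power2_eq_square)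
        then show ?thesis by (simp only: Q_def sum.distrib sum_distrib_left)
      qed
      also have "(\<Sum>a\<in>E. \<Sum>b\<in>E. M a b * f a * p b) = (\<Sum>b\<in>E. M e b * f b)"
        using e fin by (simp add: p_def if_distrib [of "\<lambda>x. _ * x"] sym [of e] cong: if_cong)
      also have "(\<Sum>a\<in>E. \<Sum>b\<in>E. M a b * f b * p a) = (\<Sum>b\<in>E. M e b * f b)"
        using e fin by (simp add: sum_distrib_right [symmetric])
          (simp add: p_def if_distrib [of "\<lambda>x. _ * x"] cong: if_cong)
      also have "(\<Sum>a\<in>E. \<Sum>b\<in>E. M a b * p b * p a) = M e e"
        using e fin by (simp add: sum_distrib_right [symmetric])
          (simp add: p_def if_distrib [of "\<lambda>x. _ * x"] cong: if_cong)
      finally have 2: "Q (\<lambda>e'. f e' + t * p e')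
          = lam + 2 * t * (\<Sum>b\<in>E. M e b * f b) + t\<^sup>2 * M e e"
        by (simp add: lam_def)
      show ?thesis using bound [of "\<lambda>e'. f e' + t * p e'"]
        unfolding 1 2 by (simp add: f D_def C_def algebra_simps)
    qed
    note quad = this
    have "D = 0"
    proof (rule ccontr)
      assume D: "D \<noteq> 0"
      \<comment> \<open>At \<open>t = - D / k\<close> the quadratic is negative, because
        \<open>C / k < 1 < 2\<close>.\<close>
      define k where "k = \<bar>C\<bar> + 1"
      have k: "k > 0" "C < k" by (auto simp: k_def)
      have "2 * (- D / k) * D + (- D / k)\<^sup>2 * C = (D\<^sup>2 / k) * (C / k - 2)"
        using k by (simp add: field_simps power2_eq_square)
      moreover have "D\<^sup>2 / k > 0" using D k by simp
      moreover have "C / k - 2 < 0" using k by (simp add: field_simps)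
      ultimately have "2 * (- D / k) * D + (- D / k)\<^sup>2 * C < 0"
        by (metis mult_pos_neg)
      then show False using quad [of "- D / k"] by linarith
    qed
    then show ?thesis by (simp add: D_def)
  qed
  show thesis
    using that [of f lam] f eig bound by (simp add: N_def Q_def)
qed

section \<open>The Ricci form as a sum over vertices\<close>

definition incident :: "'a sgraph \<Rightarrow> 'a \<Rightarrow> 'a set set" where
  "incident G z = {e \<in> gedges G. z \<in> e}"

text \<open>The form of \<open>(J - 2 I) / d\<close> on the \<open>d\<close> edges at
  \<open>z\<close>, with \<open>J\<close> the all-ones matrix. An isolated vertex contributes
  0.\<close>

definition vertex_form :: "'a sgraph \<Rightarrow> ('a set \<Rightarrow> real) \<Rightarrow> 'a \<Rightarrow> real" where
  "vertex_form G f z =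
     ((\<Sum>e\<in>incident G z. f e)\<^sup>2 - 2 * (\<Sum>e\<in>incident G z. (f e)\<^sup>2)) / real (card (incident G z))"

lemma simple_graph_finite:
  assumes "simple_graph G"
  shows "finite (gverts G)" "finite (gedges G)" "\<And>e. e \<in> gedges G \<Longrightarrow> e \<subseteq> gverts G"
    "\<And>z. finite (incident G z)"
proof -
  show "finite (gverts G)" and sub: "\<And>e. e \<in> gedges G \<Longrightarrow> e \<subseteq> gverts G"
    using assms by (auto simp: simple_graph_def)
  then show "finite (gedges G)"
    by (meson PowI finite_Pow_iff finite_subset subsetI)
  then show "finite (incident G z)" for z by (simp add: incident_def)
qed

text \<open>Double counting: every edge has exactly two ends.\<close>

lemma sum_edges_incident:
  assumes "simple_graph G"
  shows "(\<Sum>z\<in>gverts G. \<Sum>e\<in>incident G z. f e) = (\<Sum>e\<in>gedges G. 2 * f e :: real)"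
proof -
  note fin = simple_graph_finite [OF assms]
  have "(\<Sum>z\<in>gverts G. \<Sum>e\<in>incident G z. f e)
      = (\<Sum>e\<in>gedges G. \<Sum>z | z \<in> gverts G \<and> z \<in> e. f e)"
    unfolding incident_def by (rule sum.swap_restrict) (use fin in auto)
  also have "\<dots> = (\<Sum>e\<in>gedges G. 2 * f e)"
  proof (rule sum.cong [OF refl])
    fix e assume e: "e \<in> gedges G"
    then have "{z. z \<in> gverts G \<and> z \<in> e} = e" using fin(3) by blast
    moreover have "card e = 2" using assms e by (auto simp: simple_graph_def)
    ultimately show "(\<Sum>z | z \<in> gverts G \<and> z \<in> e. f e) = 2 * f e" by simp
  qed
  finally show ?thesis .
qed

text \<open>With \<open>b\<close> the unsigned incidence matrix, the entries of the Ricci matrix are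
  \<open>\<Sum>z. b z e * b z e' / d z\<close>, except that the diagonal has the opposite sign; this
  is corrected by subtracting twice the diagonal.\<close>

lemma ricci_form_eq:
  assumes G: "simple_graph G"
  shows "(\<Sum>e\<in>gedges G. \<Sum>e'\<in>gedges G. ricci_entry G e e' * f e * f e')
    = (\<Sum>z\<in>gverts G. vertex_form G f z)"
proof -
  note fin = simple_graph_finite [OF G]
  define E V d where "E = gedges G" and "V = gverts G" and "d z = real (vdegree G z)" for z
  define b :: "'a \<Rightarrow> 'a set \<Rightarrow> real" where "b z e = of_bool (z \<in> e)" for z e
  have finE: "finite E" and finV: "finite V" using fin by (auto simp: E_def V_def)
  have inc: "(\<Sum>e\<in>incident G z. h e) = (\<Sum>e\<in>E. b z e * h e)" for z and h :: "'a set \<Rightarrow> real"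
    unfolding incident_def E_def [symmetric] sum.inter_filter [OF finE]
    by (rule sum.cong) (auto simp: b_def)
  have supp: "(\<Sum>z\<in>S. h z) = (\<Sum>z\<in>V. of_bool (z \<in> S) * h z)" if "S \<subseteq> V"
    for S and h :: "'a \<Rightarrow> real"
  proof -
    have "(\<Sum>z\<in>S. h z) = (\<Sum>z\<in>V. if z \<in> S then h z else 0)"
      using sum.inter_restrict [OF finV, of h S] that by (simp add: Int_absorb1)
    also have "\<dots> = (\<Sum>z\<in>V. of_bool (z \<in> S) * h z)"
      by (rule sum.cong) auto
    finally show ?thesis .
  qed
  have entry: "ricci_entry G e e' = (\<Sum>z\<in>V. b z e * b z e' / d z)
      - (if e = e' then 2 * (\<Sum>z\<in>V. b z e / d z) else 0)" if "e \<in> E" "e' \<in> E" for e e'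
  proof -
    have e: "e \<subseteq> V" "e \<inter> e' \<subseteq> V" using that fin(3) by (auto simp: E_def V_def)
    show ?thesis
    proof (cases "e = e'")
      case True
      then show ?thesis
        using supp [OF e(1)] by (simp add: ricci_entry_def b_def d_def of_bool_conj [symmetric])
    next
      case False
      then show ?thesis
        by (simp add: ricci_entry_def supp [OF e(2)] b_def d_def of_bool_conj)
    qed
  qed
  have term_eq: "ricci_entry G e e' * f e * f e' = (\<Sum>z\<in>V. (b z e * f e) * (b z e' * f e') / d z)
      - (if e = e' then 2 * (\<Sum>z\<in>V. b z e * (f e)\<^sup>2 / d z) else 0)"
    if "e \<in> E" "e' \<in> E" for e e'
  proof -
    have "(\<Sum>z\<in>V. (b z e * f e) * (b z e' * f e') / d z) = (\<Sum>z\<in>V. b z e * b z e' / d z) * f e * f e'"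
      unfolding sum_distrib_right by (rule sum.cong) auto
    moreover have "(\<Sum>z\<in>V. b z e * (f e)\<^sup>2 / d z) = (\<Sum>z\<in>V. b z e / d z) * f e * f e"
      unfolding sum_distrib_right by (rule sum.cong) (auto simp: power2_eq_square)
    ultimately show ?thesis
      by (auto simp: entry [OF that] left_diff_distrib)
  qed
  have "(\<Sum>e\<in>E. \<Sum>e'\<in>E. ricci_entry G e e' * f e * f e')
      = (\<Sum>e\<in>E. \<Sum>e'\<in>E. (\<Sum>z\<in>V. (b z e * f e) * (b z e' * f e') / d z)
          - (if e = e' then 2 * (\<Sum>z\<in>V. b z e * (f e)\<^sup>2 / d z) else 0))"
    by (intro sum.cong refl term_eq)
  also have "\<dots> = (\<Sum>e\<in>E. \<Sum>e'\<in>E. \<Sum>z\<in>V. (b z e * f e) * (b z e' * f e') / d z)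
      - (\<Sum>e\<in>E. 2 * (\<Sum>z\<in>V. b z e * (f e)\<^sup>2 / d z))"
    using finE by (simp add: sum_subtractf)
  \<comment> \<open>With the vertex sum moved outermost, the double sum over edges factors into a
    square.\<close>
  also have "(\<Sum>e\<in>E. \<Sum>e'\<in>E. \<Sum>z\<in>V. (b z e * f e) * (b z e' * f e') / d z)
      = (\<Sum>e\<in>E. \<Sum>z\<in>V. \<Sum>e'\<in>E. (b z e * f e) * (b z e' * f e') / d z)"
    by (rule sum.cong [OF refl], rule sum.swap)
  also have "\<dots> = (\<Sum>z\<in>V. \<Sum>e\<in>E. \<Sum>e'\<in>E. (b z e * f e) * (b z e' * f e') / d z)"
    by (rule sum.swap)
  also have "\<dots> = (\<Sum>z\<in>V. (\<Sum>e\<in>E. b z e * f e)\<^sup>2 / d z)"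
    by (simp add: power2_eq_square sum_product sum_divide_distrib)
  also have "(\<Sum>e\<in>E. 2 * (\<Sum>z\<in>V. b z e * (f e)\<^sup>2 / d z))
      = (\<Sum>z\<in>V. 2 * (\<Sum>e\<in>E. b z e * (f e)\<^sup>2) / d z)"
    by (simp add: sum_distrib_left sum_divide_distrib) (rule sum.swap)
  also have "(\<Sum>z\<in>V. (\<Sum>e\<in>E. b z e * f e)\<^sup>2 / d z) - \<dots> = (\<Sum>z\<in>V. vertex_form G f z)"
    unfolding vertex_form_def inc sum_subtractf [symmetric] diff_divide_distrib
    unfolding d_def vdegree_def incident_def ..
  finally show ?thesis by (simp add: E_def V_def)
qed

text \<open>Rayleigh's principle: the maximum of the form on the sphere is an eigenvalue, and any
  eigenvalue is the quotient of form and squared norm at its eigenvector, hence no larger.\<close>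

lemma lambda_max_variational:
  assumes G: "simple_graph G" and ne: "gedges G \<noteq> {}"
  shows "(\<Sum>z\<in>gverts G. vertex_form G h z)
      \<le> lambda_max (ricci_matrix G) * (\<Sum>e\<in>gedges G. (h e)\<^sup>2)" (is ?le)
    and "\<exists>f. (\<Sum>e\<in>gedges G. (f e)\<^sup>2) = 1 \<and>
      (\<Sum>z\<in>gverts G. vertex_form G f z) = lambda_max (ricci_matrix G)" (is ?ex)
proof -
  define E where "E = gedges G"
  define Q where "Q f = (\<Sum>e\<in>E. \<Sum>e'\<in>E. ricci_entry G e e' * f e * f e')" for f
  note fin = simple_graph_finite [OF G]
  have finE: "finite E" and neE: "E \<noteq> {}" using fin(2) ne by (auto simp: E_def)
  obtain lam f where N: "(\<Sum>e\<in>E. (f e)\<^sup>2) = 1"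
    and ev: "\<And>e. e \<in> E \<Longrightarrow> (\<Sum>e'\<in>E. ricci_entry G e e' * f e') = lam * f e"
    and le: "\<And>g. Q g \<le> lam * (\<Sum>e\<in>E. (g e)\<^sup>2)"
    unfolding Q_def
    by (rule symmetric_form_maximizer [of E "ricci_entry G", OF finE neE ricci_entry_sym]) blast
  have Qev: "Q f = k * (\<Sum>e\<in>E. (f e)\<^sup>2)"
    if "\<And>e. e \<in> E \<Longrightarrow> (\<Sum>e'\<in>E. ricci_entry G e e' * f e') = k * f e" for k f
  proof -
    have "Q f = (\<Sum>e\<in>E. f e * (\<Sum>e'\<in>E. ricci_entry G e e' * f e'))"
      by (simp add: Q_def sum_distrib_left mult_ac)
    also have "\<dots> = (\<Sum>e\<in>E. f e * (k * f e))"
      by (rule sum.cong [OF refl]) (simp add: that)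
    finally show ?thesis by (simp add: sum_distrib_left power2_eq_square mult_ac)
  qed
  have finspec: "finite (spectrum (ricci_matrix G))"
    by (rule card_finite_spectrum [of _ "card E"]) (simp add: ricci_matrix_def E_def)
  have "\<exists>e\<in>E. f e \<noteq> 0"
    using N by (metis (no_types, lifting) power_zero_numeral sum.neutral zero_neq_one)
  then have "lam \<in> spectrum (ricci_matrix G)"
    using ev by (auto simp: spectrum_def eigenvalue_ricci_matrix_iff [OF fin(2)] E_def [symmetric])
  moreover have "k \<le> lam" if "k \<in> spectrum (ricci_matrix G)" for k
  proof -
    obtain u where u: "\<exists>e\<in>E. u e \<noteq> 0"
      and uev: "\<And>e. e \<in> E \<Longrightarrow> (\<Sum>e'\<in>E. ricci_entry G e e' * u e') = k * u e"
      using \<open>k \<in> _\<close>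
      by (auto simp: spectrum_def eigenvalue_ricci_matrix_iff [OF fin(2)] E_def [symmetric])
    have "(\<Sum>e\<in>E. (u e)\<^sup>2) > 0"
      using u fin(2) by (auto simp: E_def intro: sum_pos2)
    moreover have "k * (\<Sum>e\<in>E. (u e)\<^sup>2) \<le> lam * (\<Sum>e\<in>E. (u e)\<^sup>2)"
      using le [of u] Qev [OF uev] by simp
    ultimately show ?thesis by simp
  qed
  ultimately have lam: "lambda_max (ricci_matrix G) = lam"
    unfolding lambda_max_def using finspec by (intro Max_eqI) auto
  show ?le using le [of h] by (simp add: Q_def E_def lam ricci_form_eq [OF G])
  show ?ex using N Qev [OF ev] by (auto simp: Q_def E_def lam ricci_form_eq [OF G])
qed

text \<open>Cauchy-Schwarz bounds the form at each vertex by the sum of squares over its edges, and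
  each edge is counted at both ends.\<close>

lemma lambda_max_le_2:
  assumes G: "simple_graph G" and ne: "gedges G \<noteq> {}"
  shows "lambda_max (ricci_matrix G) \<le> 2"
proof -
  obtain f where N: "(\<Sum>e\<in>gedges G. (f e)\<^sup>2) = 1"
    and Q: "(\<Sum>z\<in>gverts G. vertex_form G f z) = lambda_max (ricci_matrix G)"
    using lambda_max_variational(2) [OF G ne] by blast
  have "vertex_form G f z \<le> (\<Sum>e\<in>incident G z. (f e)\<^sup>2)" for z
  proof -
    define c where "c = real (card (incident G z))"
    define s where "s = (\<Sum>e\<in>incident G z. (f e)\<^sup>2)"
    have s: "s \<ge> 0" by (simp add: s_def sum_nonneg)
    have "(\<Sum>e\<in>incident G z. f e)\<^sup>2 \<le> c * s"
      using sum_squared_le_sum_of_squares [of f "incident G z"] by (simp add: c_def s_def mult.commute)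
    then have "(\<Sum>e\<in>incident G z. f e)\<^sup>2 - 2 * s \<le> s * c" using s by (simp add: mult.commute)
    moreover have "c \<ge> 0" by (simp add: c_def)
    ultimately show ?thesis
      unfolding vertex_form_def c_def [symmetric] s_def [symmetric]
      using s by (cases "c = 0") (auto simp: divide_le_eq)
  qed
  then have "(\<Sum>z\<in>gverts G. vertex_form G f z) \<le> (\<Sum>z\<in>gverts G. \<Sum>e\<in>incident G z. (f e)\<^sup>2)"
    by (intro sum_mono)
  also have "\<dots> = 2" using N by (simp add: sum_edges_incident [OF G] sum_distrib_left [symmetric])
  finally show ?thesis using Q by simp
qed

subsection \<open>Coordinates on the single-vertex defect\<close>

definition cycle_edge :: "nat \<Rightarrow> nat \<Rightarrow> (nat + 'a) set" where
  "cycle_edge g i = Inl ` {i, Suc i mod g}"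

definition tree_edge :: "'a \<Rightarrow> 'a set \<Rightarrow> (nat + 'a) set" where
  "tree_edge r e = glue_vertex 0 r ` e"

text \<open>Edge \<open>i\<close> joins the vertices \<open>i\<close> and \<open>i + 1\<close>
  modulo \<open>g\<close>, so vertex \<open>i > 0\<close> lies between the edges
  \<open>i - 1\<close> and \<open>i\<close>. Vertex 0 is left out: it carries the tree and has its
  own term in \<open>defect_form\<close>.\<close>

definition cycle_energy :: "nat \<Rightarrow> (nat \<Rightarrow> real) \<Rightarrow> real" where
  "cycle_energy g a = (\<Sum>i=1..<g. (a (i - 1) - a i)\<^sup>2)"

text \<open>The Ricci form in coordinates \<open>\<beta>\<close> on the edges of \<open>B\<close>
  and \<open>a\<close> on the cycle: the non-root vertices of \<open>B\<close>, then the glued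
  vertex, whose degree is two more than that of \<open>r\<close> in \<open>B\<close>, then the cycle
  vertices of degree 2.\<close>

definition defect_form :: "'a sgraph \<Rightarrow> 'a \<Rightarrow> nat \<Rightarrow> ('a set \<Rightarrow> real) \<Rightarrow> (nat \<Rightarrow> real) \<Rightarrow> real" where
  "defect_form B r g \<beta> a = (\<Sum>b\<in>gverts B - {r}. vertex_form B \<beta> b)
     + (((\<Sum>e\<in>incident B r. \<beta> e) + a 0 + a (g - 1))\<^sup>2
         - 2 * ((\<Sum>e\<in>incident B r. (\<beta> e)\<^sup>2) + (a 0)\<^sup>2 + (a (g - 1))\<^sup>2))
       / (real (card (incident B r)) + 2)
     - cycle_energy g a / 2"

definition defect_norm :: "'a sgraph \<Rightarrow> nat \<Rightarrow> ('a set \<Rightarrow> real) \<Rightarrow> (nat \<Rightarrow> real) \<Rightarrow> real" where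
  "defect_norm B g \<beta> a = (\<Sum>e\<in>gedges B. (\<beta> e)\<^sup>2) + (\<Sum>i<g. (a i)\<^sup>2)"

lemma inj_glue_vertex: "inj (glue_vertex v r)"
  by (auto simp: inj_def glue_vertex_def split: if_splits)

lemma inj_tree_edge: "inj (tree_edge r)"
  using inj_glue_vertex [of 0 r] unfolding tree_edge_def inj_def by (metis inj_image_eq_iff inj_glue_vertex)

lemma gedges_single_defect:
  "gedges (single_defect_graph g B r) = cycle_edge g ` {..<g} \<union> tree_edge r ` gedges B"
proof -
  have "{{i, Suc i mod g} | i. i < g} = (\<lambda>i. {i, Suc i mod g}) ` {..<g}" by auto
  then show ?thesis
    by (simp add: single_defect_graph_def attach_def cycle_graph_def cycle_edge_def [abs_def]
        tree_edge_def [abs_def] image_image)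
qed

text \<open>For \<open>g = 2\<close> the indices 0 and 1 would give the same edge.\<close>

lemma inj_on_cycle_edge:
  assumes "3 \<le> g"
  shows "inj_on (cycle_edge g) {..<g}"
proof (rule inj_onI)
  fix i j assume ij: "i \<in> {..<g}" "j \<in> {..<g}" and eq: "cycle_edge g i = cycle_edge g j"
  have "{i, Suc i mod g} = {j, Suc j mod g}"
    using eq unfolding cycle_edge_def by (subst (asm) inj_image_eq_iff) auto
  then show "i = j"
    using ij assms by (auto simp: doubleton_eq_iff mod_Suc split: if_splits)
qed

section \<open>Edges and incidences of the defect graph\<close>

locale defect_data =
  fixes B :: "'a sgraph" and r :: 'a
  assumes simple: "simple_graph B" and root: "r \<in> gverts B"
begin

lemma gverts_single_defect:
  assumes "3 \<le> g"
  shows "gverts (single_defect_graph g B r) = Inl ` {..<g} \<union> Inr ` (gverts B - {r})"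
  using assms root
  by (auto simp: single_defect_graph_def attach_def cycle_graph_def glue_vertex_def image_iff)

text \<open>One of the two ends of an edge differs from the root. This separates tree edges from
  cycle edges, which contain only \<open>Inl\<close> vertices.\<close>

lemma Inr_in_tree_edge:
  assumes "e \<in> gedges B"
  shows "\<exists>b. Inr b \<in> tree_edge r e"
proof -
  obtain b where "b \<in> e" "b \<noteq> r"
    using simple assms unfolding simple_graph_def by (metis insertCI)
  then have "Inr b = glue_vertex (0::nat) r b" "b \<in> e" by (simp_all add: glue_vertex_def)
  then show ?thesis unfolding tree_edge_def by (metis imageI)
qed

lemma cycle_edge_neq_tree_edge:
  assumes "e \<in> gedges B"
  shows "cycle_edge g i \<noteq> tree_edge r e"
  using Inr_in_tree_edge [OF assms] by (auto simp: cycle_edge_def)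

lemma simple_single_defect:
  assumes g: "3 \<le> g"
  shows "simple_graph (single_defect_graph g B r)"
  unfolding simple_graph_def
proof (intro conjI ballI)
  note fin = simple_graph_finite [OF simple]
  show "finite (gverts (single_defect_graph g B r))"
    using fin by (simp add: gverts_single_defect [OF g])
  fix e assume "e \<in> gedges (single_defect_graph g B r)"
  then consider i where "i < g" "e = cycle_edge g i" | e' where "e' \<in> gedges B" "e = tree_edge r e'"
    by (auto simp: gedges_single_defect)
  then show "\<exists>x\<in>gverts (single_defect_graph g B r). \<exists>y\<in>gverts (single_defect_graph g B r). x \<noteq> y \<and> e = {x, y}"
  proof cases
    case 1
    have "Suc i mod g \<noteq> i" "Suc i mod g < g" using 1 g by (auto simp: mod_Suc)
    then have "Inl i \<in> gverts (single_defect_graph g B r)"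
        "Inl (Suc i mod g) \<in> gverts (single_defect_graph g B r)"
      using 1 by (simp_all add: gverts_single_defect [OF g])
    moreover have "Inl i \<noteq> (Inl (Suc i mod g) :: nat + 'a)" using \<open>Suc i mod g \<noteq> i\<close> by simp
    moreover have "e = {Inl i, Inl (Suc i mod g)}" using 1 by (simp add: cycle_edge_def)
    ultimately show ?thesis by metis
  next
    case 2
    then obtain x y where xy: "x \<in> gverts B" "y \<in> gverts B" "x \<noteq> y" "e' = {x, y}"
      using simple by (auto simp: simple_graph_def)
    have mem: "glue_vertex 0 r z \<in> gverts (single_defect_graph g B r)" if "z \<in> gverts B" for z
      using that by (simp add: single_defect_graph_def attach_def)
    have "glue_vertex (0::nat) r x \<noteq> glue_vertex 0 r y"
      using xy(3) inj_glue_vertex [of "0::nat" r] by (simp add: inj_eq)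
    moreover have "e = {glue_vertex 0 r x, glue_vertex 0 r y}"
      using xy 2 by (simp add: tree_edge_def)
    ultimately show ?thesis using mem [OF xy(1)] mem [OF xy(2)] by metis
  qed
qed

lemma incident_Inr:
  assumes "b \<noteq> r"
  shows "incident (single_defect_graph g B r) (Inr b) = tree_edge r ` incident B b"
proof -
  have "Inr b \<in> tree_edge r e \<longleftrightarrow> b \<in> e" for e
    using assms by (auto simp: tree_edge_def glue_vertex_def image_iff)
  moreover have "Inr b \<notin> cycle_edge g i" for i by (auto simp: cycle_edge_def)
  ultimately show ?thesis unfolding incident_def gedges_single_defect by blast
qed

lemma incident_Inl:
  assumes "0 < i" "i < g"
  shows "incident (single_defect_graph g B r) (Inl i) = {cycle_edge g (i - 1), cycle_edge g i}"
proof -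
  have tree: "Inl i \<notin> tree_edge r e" for e
    using assms by (auto simp: tree_edge_def glue_vertex_def split: if_splits)
  have "(Inl i :: nat + 'a) \<in> cycle_edge g j \<longleftrightarrow> j = i - 1 \<or> j = i" if "j < g" for j
    using that assms by (auto simp: cycle_edge_def mod_Suc)
  moreover have "i - 1 < g" using assms by simp
  ultimately show ?thesis
    using tree assms unfolding incident_def gedges_single_defect by blast
qed

lemma incident_Inl_0:
  assumes "3 \<le> g"
  shows "incident (single_defect_graph g B r) (Inl 0)
    = {cycle_edge g 0, cycle_edge g (g - 1)} \<union> tree_edge r ` incident B r"
proof -
  have tree: "Inl 0 \<in> tree_edge r e \<longleftrightarrow> r \<in> e" for e
    by (auto simp: tree_edge_def glue_vertex_def image_iff)
  have "(Inl 0 :: nat + 'a) \<in> cycle_edge g j \<longleftrightarrow> j = 0 \<or> j = g - 1" if "j < g" for j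
    using that assms by (auto simp: cycle_edge_def mod_Suc)
  moreover have "g - 1 < g" "0 < g" using assms by simp_all
  ultimately show ?thesis
    using tree unfolding incident_def gedges_single_defect by blast
qed

text \<open>Relating \<open>f\<close> to \<open>\<beta>\<close> and \<open>a\<close> by hypotheses
  allows both uses: restricting a given \<open>f\<close> to coordinates, and building
  \<open>f\<close> from given coordinates.\<close>

lemma single_defect_form_eq:
  assumes g: "3 \<le> g"
    and tree: "\<And>e. e \<in> gedges B \<Longrightarrow> f (tree_edge r e) = \<beta> e"
    and cyc: "\<And>i. i < g \<Longrightarrow> f (cycle_edge g i) = a i"
  shows "(\<Sum>z\<in>gverts (single_defect_graph g B r). vertex_form (single_defect_graph g B r) f z)
      = defect_form B r g \<beta> a"
    and "(\<Sum>e\<in>gedges (single_defect_graph g B r). (f e)\<^sup>2) = defect_norm B g \<beta> a"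
proof -
  let ?G = "single_defect_graph g B r"
  note fin = simple_graph_finite [OF simple]
  note inj = inj_on_subset [OF inj_tree_edge subset_UNIV]
  have treeS: "(\<Sum>e\<in>tree_edge r ` S. h (f e)) = (\<Sum>e\<in>S. h (\<beta> e))" if "S \<subseteq> gedges B"
    for S and h :: "real \<Rightarrow> real"
    using that tree by (subst sum.reindex [OF inj]) (auto intro!: sum.cong)
  have inc: "incident B z \<subseteq> gedges B" for z by (auto simp: incident_def)
  have neq: "cycle_edge g i \<noteq> cycle_edge g j" if "i < g" "j < g" "i \<noteq> j" for i j
    using inj_on_cycle_edge [OF g] that by (auto simp: inj_on_def)
  have disj: "cycle_edge g ` I \<inter> tree_edge r ` S = {}" if "S \<subseteq> gedges B" for I S
    using that cycle_edge_neq_tree_edge by blast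
  have Inr: "vertex_form ?G f (Inr b) = vertex_form B \<beta> b" if "b \<in> gverts B - {r}" for b
    using that treeS [OF inc [of b], of "\<lambda>x. x"] treeS [OF inc [of b], of "\<lambda>x. x\<^sup>2"]
    by (simp add: vertex_form_def incident_Inr card_image [OF inj])
  have Inl: "vertex_form ?G f (Inl i) = - ((a (i - 1) - a i)\<^sup>2 / 2)" if "i \<in> {1..<g}" for i
  proof -
    have "cycle_edge g (i - 1) \<noteq> (cycle_edge g i :: (nat + 'a) set)" using that by (intro neq) auto
    moreover have "i - 1 < g" "i < g" "0 < i" using that by auto
    ultimately show ?thesis
      by (simp add: vertex_form_def incident_Inl cyc field_simps power2_eq_square)
  qed
  have Inl0: "vertex_form ?G f (Inl 0)
      = (((\<Sum>e\<in>incident B r. \<beta> e) + a 0 + a (g - 1))\<^sup>2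
         - 2 * ((\<Sum>e\<in>incident B r. (\<beta> e)\<^sup>2) + (a 0)\<^sup>2 + (a (g - 1))\<^sup>2))
       / (real (card (incident B r)) + 2)"
  proof -
    let ?C = "{cycle_edge g 0, cycle_edge g (g - 1)} :: (nat + 'a) set set"
    have ne: "cycle_edge g 0 \<noteq> (cycle_edge g (g - 1) :: (nat + 'a) set)" using g by (intro neq) auto
    have d: "?C \<inter> tree_edge r ` incident B r = {}" using disj [OF inc, of "{0, g - 1}"] by simp
    have "g - 1 < g" "0 < g" using g by auto
    then have S: "(\<Sum>e\<in>?C \<union> tree_edge r ` incident B r. h (f e))
        = (\<Sum>e\<in>incident B r. h (\<beta> e)) + h (a 0) + h (a (g - 1))" for h :: "real \<Rightarrow> real"
      using ne fin(4) by (subst sum.union_disjoint [OF _ _ d]) (auto simp: treeS [OF inc] cyc)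
    have "card (?C \<union> tree_edge r ` incident B r) = card (incident B r) + 2"
      using ne fin(4) by (subst card_Un_disjoint [OF _ _ d]) (auto simp: card_image [OF inj])
    then show ?thesis
      using S [of "\<lambda>x. x"] S [of "\<lambda>x. x\<^sup>2"] by (simp add: vertex_form_def incident_Inl_0 [OF g])
  qed
  have "{..<g} = insert 0 {1..<g}" using g by auto
  then have cyc_sum: "(\<Sum>i<g. vertex_form ?G f (Inl i))
      = vertex_form ?G f (Inl 0) + (\<Sum>i=1..<g. vertex_form ?G f (Inl i))"
    by simp
  have "(\<Sum>z\<in>gverts ?G. vertex_form ?G f z)
      = (\<Sum>z\<in>Inl ` {..<g}. vertex_form ?G f z) + (\<Sum>z\<in>Inr ` (gverts B - {r}). vertex_form ?G f z)"
    unfolding gverts_single_defect [OF g] using fin(1) by (intro sum.union_disjoint) auto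
  also have "\<dots> = (vertex_form ?G f (Inl 0) + (\<Sum>i=1..<g. vertex_form ?G f (Inl i)))
        + (\<Sum>b\<in>gverts B - {r}. vertex_form ?G f (Inr b))"
    unfolding cyc_sum [symmetric] by (simp add: sum.reindex)
  also have "\<dots> = defect_form B r g \<beta> a"
    using Inl by (simp add: Inr Inl0 defect_form_def cycle_energy_def sum_negf sum_divide_distrib)
  finally show "(\<Sum>z\<in>gverts ?G. vertex_form ?G f z) = defect_form B r g \<beta> a" .
  show "(\<Sum>e\<in>gedges ?G. (f e)\<^sup>2) = defect_norm B g \<beta> a"
    unfolding gedges_single_defect defect_norm_def
    using fin(2) treeS [OF subset_refl, of "\<lambda>x. x\<^sup>2"]
    by (simp add: sum.union_disjoint [OF _ _ disj] sum.reindex [OF inj_on_cycle_edge [OF g]] cyc)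
qed

lemma lambda_max_defect:
  assumes g: "3 \<le> g"
  defines "lam \<equiv> lambda_max (ricci_matrix (single_defect_graph g B r))"
  shows "defect_form B r g \<beta> a \<le> lam * defect_norm B g \<beta> a"
    and "\<exists>\<beta> a. defect_norm B g \<beta> a = 1 \<and> defect_form B r g \<beta> a = lam"
    and "lam \<le> 2"
proof -
  have ne: "gedges (single_defect_graph g B r) \<noteq> {}"
    using g by (simp add: gedges_single_defect lessThan_empty_iff)
  \<comment> \<open>The coordinates are read back through the inverses of the two injective edge
    maps, whose ranges on the edges are disjoint.\<close>
  define f where "f X = (if X \<in> cycle_edge g ` {..<g} then a (the_inv_into {..<g} (cycle_edge g) X)
    else \<beta> (the_inv (tree_edge r) X))" for X
  have "f (tree_edge r e) = \<beta> e" if "e \<in> gedges B" for e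
    using cycle_edge_neq_tree_edge [OF that] by (auto simp: f_def the_inv_f_f [OF inj_tree_edge])
  moreover have "f (cycle_edge g i) = a i" if "i < g" for i
    using that by (simp add: f_def the_inv_into_f_f [OF inj_on_cycle_edge [OF g]])
  ultimately show "defect_form B r g \<beta> a \<le> lam * defect_norm B g \<beta> a"
    using lambda_max_variational(1) [OF simple_single_defect [OF g] ne, of f]
    by (simp add: single_defect_form_eq [OF g, of f \<beta> a] lam_def)
  show "\<exists>\<beta> a. defect_norm B g \<beta> a = 1 \<and> defect_form B r g \<beta> a = lam"
  proof -
    obtain f where f: "(\<Sum>e\<in>gedges (single_defect_graph g B r). (f e)\<^sup>2) = 1"
      "(\<Sum>z\<in>gverts (single_defect_graph g B r). vertex_form (single_defect_graph g B r) f z) = lam"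
      using lambda_max_variational(2) [OF simple_single_defect [OF g] ne] unfolding lam_def by blast
    note eq = single_defect_form_eq [OF g, of f "\<lambda>e. f (tree_edge r e)" "\<lambda>i. f (cycle_edge g i)",
        OF refl refl]
    show ?thesis using f unfolding eq by blast
  qed
  show "lam \<le> 2"
    unfolding lam_def by (rule lambda_max_le_2 [OF simple_single_defect [OF g] ne])
qed

end

subsection \<open>Inserting zeros\<close>

text \<open>Turns a vector on a cycle of length \<open>g\<close> into a test vector on one of length
  \<open>g + d\<close>; the entry at \<open>k\<close> moves to \<open>k + d\<close>.\<close>

definition insert_zeros :: "nat \<Rightarrow> nat \<Rightarrow> (nat \<Rightarrow> real) \<Rightarrow> nat \<Rightarrow> real" where
  "insert_zeros k d a i = (if i < k then a i else if i < k + d then 0 else a (i - d))"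

lemma sum_squares_insert_zeros:
  assumes "k \<le> g"
  shows "(\<Sum>i<g + d. (insert_zeros k d a i)\<^sup>2) = (\<Sum>i<g. (a i)\<^sup>2)"
proof -
  let ?b = "\<lambda>i. (insert_zeros k d a i)\<^sup>2"
  have "(\<Sum>i<g + d. ?b i) = sum ?b {0..<k} + sum ?b {k..<k + d} + sum ?b {k + d..<g + d}"
    using assms by (simp add: lessThan_atLeast0 sum.atLeastLessThan_concat)
  also have "sum ?b {k + d..<g + d} = (\<Sum>i=k..<g. (a i)\<^sup>2)"
    by (subst sum.shift_bounds_nat_ivl) (simp add: insert_zeros_def)
  also have "sum ?b {k..<k + d} = 0"
    by (simp add: insert_zeros_def)
  also have "sum ?b {0..<k} = (\<Sum>i=0..<k. (a i)\<^sup>2)"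
    by (simp add: insert_zeros_def)
  finally show ?thesis
    using assms by (simp add: lessThan_atLeast0 sum.atLeastLessThan_concat)
qed

text \<open>Cutting the cycle between two edges replaces \<open>(x - y)\<^sup>2\<close> by \<open>x\<^sup>2 + y\<^sup>2\<close>.\<close>

lemma cycle_energy_insert_zeros:
  assumes "0 < k" "k < g" "0 < d"
  shows "cycle_energy (g + d) (insert_zeros k d a) = cycle_energy g a + 2 * a (k - 1) * a k"
proof -
  let ?b = "\<lambda>i. (insert_zeros k d a (i - 1) - insert_zeros k d a i)\<^sup>2"
  let ?c = "\<lambda>i. (a (i - 1) - a i)\<^sup>2"
  \<comment> \<open>Only the terms at the two ends of the zero block, \<open>k\<close> and
    \<open>k + d\<close>, differ from those of \<open>a\<close>. They are distinct because
    \<open>d > 0\<close>.\<close>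
  have "cycle_energy (g + d) (insert_zeros k d a)
      = sum ?b {1..<k} + (?b k + sum ?b {Suc k..<k + d} + ?b (k + d)) + sum ?b {Suc k + d..<g + d}"
  proof -
    have "sum ?b {k..<Suc (k + d)} = ?b k + sum ?b {Suc k..<k + d} + ?b (k + d)"
      using assms by (simp add: sum.atLeast_Suc_lessThan)
    moreover have "sum ?b {1..<g + d} = sum ?b {1..<k} + sum ?b {k..<Suc (k + d)} + sum ?b {Suc (k + d)..<g + d}"
      using assms by (simp add: sum.atLeastLessThan_concat del: sum.op_ivl_Suc)
    ultimately show ?thesis by (simp add: cycle_energy_def)
  qed
  also have "sum ?b {Suc k + d..<g + d} = sum ?c {Suc k..<g}"
    by (subst sum.shift_bounds_nat_ivl) (rule sum.cong, auto simp: insert_zeros_def)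
  also have "?b (k + d) = (a k)\<^sup>2"
    using assms by (auto simp: insert_zeros_def)
  also have "sum ?b {Suc k..<k + d} = 0"
    by (rule sum.neutral) (auto simp: insert_zeros_def)
  also have "?b k = (a (k - 1))\<^sup>2"
    using assms by (simp add: insert_zeros_def)
  also have "sum ?b {1..<k} = sum ?c {1..<k}"
    by (rule sum.cong) (auto simp: insert_zeros_def)
  finally have "cycle_energy (g + d) (insert_zeros k d a)
      = sum ?c {1..<k} + ((a (k - 1))\<^sup>2 + (a k)\<^sup>2) + sum ?c {Suc k..<g}"
    by simp
  moreover have "cycle_energy g a = sum ?c {1..<k} + (?c k + sum ?c {Suc k..<g})"
  proof -
    have "sum ?c {1..<g} = sum ?c {1..<k} + sum ?c {k..<g}"
      using assms by (simp add: sum.atLeastLessThan_concat)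
    also have "sum ?c {k..<g} = ?c k + sum ?c {Suc k..<g}"
      using assms by (simp add: sum.atLeast_Suc_lessThan)
    finally show ?thesis by (simp add: cycle_energy_def)
  qed
  ultimately show ?thesis by (simp add: power2_diff)
qed

text \<open>Since \<open>0 < k < g\<close>, the first and last values survive, so the term at the
  glued vertex is unchanged. The energy enters with factor \<open>-1/2\<close>.\<close>

lemma defect_insert_zeros:
  assumes "0 < k" "k < g" "0 < d"
  shows "defect_form B r (g + d) \<beta> (insert_zeros k d a) = defect_form B r g \<beta> a - a (k - 1) * a k"
    and "defect_norm B (g + d) \<beta> (insert_zeros k d a) = defect_norm B g \<beta> a"
proof -
  have "insert_zeros k d a 0 = a 0" "insert_zeros k d a (g + d - 1) = a (g - 1)"
    using assms by (auto simp: insert_zeros_def)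
  then show "defect_form B r (g + d) \<beta> (insert_zeros k d a) = defect_form B r g \<beta> a - a (k - 1) * a k"
    by (simp add: defect_form_def cycle_energy_insert_zeros [OF assms] add_divide_distrib)
  show "defect_norm B (g + d) \<beta> (insert_zeros k d a) = defect_norm B g \<beta> a"
    using assms by (simp add: defect_norm_def sum_squares_insert_zeros)
qed

text \<open>The \<open>g - 1\<close> products of neighbours sum to at most
  \<open>\<Sum>i<g. (a i)^2 \<le> 1\<close> by the arithmetic-geometric mean inequality, so one of
  them is at most the average.\<close>

lemma exists_small_cut:
  fixes a :: "nat \<Rightarrow> real"
  assumes "2 \<le> g" and "(\<Sum>i<g. (a i)\<^sup>2) \<le> 1"
  shows "\<exists>k. 0 < k \<and> k < g \<and> a (k - 1) * a k \<le> 1 / real (g - 1)"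
proof (rule ccontr)
  assume "\<not> ?thesis"
  then have "\<And>k. k \<in> {1..<g} \<Longrightarrow> 1 / real (g - 1) < a (k - 1) * a k" by force
  then have "(\<Sum>k=1..<g. 1 / real (g - 1)) < (\<Sum>k=1..<g. a (k - 1) * a k)"
    using assms(1) by (intro sum_strict_mono) auto
  then have "1 < (\<Sum>k=1..<g. a (k - 1) * a k)" using assms(1) by simp
  also have "\<dots> \<le> (\<Sum>k=1..<g. (a (k - 1))\<^sup>2 / 2 + (a k)\<^sup>2 / 2)"
  proof (rule sum_mono)
    fix k
    show "a (k - 1) * a k \<le> (a (k - 1))\<^sup>2 / 2 + (a k)\<^sup>2 / 2"
      using sum_squares_bound [of "a (k - 1)" "a k"] by simp
  qed
  also have "\<dots> = (\<Sum>k=1..<g. (a (k - 1))\<^sup>2) / 2 + (\<Sum>k=1..<g. (a k)\<^sup>2) / 2"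
    by (simp add: sum.distrib sum_divide_distrib)
  also have "(\<Sum>k=1..<g. (a (k - 1))\<^sup>2) = (\<Sum>k<g - 1. (a k)\<^sup>2)"
    by (rule sum.reindex_bij_witness [of _ Suc "\<lambda>k. k - 1"]) auto
  also have "\<dots> \<le> (\<Sum>i<g. (a i)\<^sup>2)" by (rule sum_mono2) auto
  also have "(\<Sum>k=1..<g. (a k)\<^sup>2) \<le> (\<Sum>i<g. (a i)\<^sup>2)" by (rule sum_mono2) auto
  finally show False using assms(2) by simp
qed

subsection \<open>Convergence and positivity\<close>

text \<open>The limit is the supremum \<open>L\<close> of \<open>x n - c n\<close>: one index with
  \<open>x m - c m\<close> above \<open>y\<close> keeps all later terms above \<open>y\<close>,
  while \<open>x n \<le> L + c n\<close> always.\<close>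

lemma almost_increasing_convergent:
  fixes x c :: "nat \<Rightarrow> real"
  assumes bound: "\<And>n. N \<le> n \<Longrightarrow> x n \<le> K"
    and incr: "\<And>m n. N \<le> m \<Longrightarrow> m \<le> n \<Longrightarrow> x m - c m \<le> x n"
    and lim: "c \<longlonglongrightarrow> 0"
  shows "convergent x"
proof -
  define L where "L = (SUP n\<in>{N..}. x n - c n)"
  have bdd: "bdd_above ((\<lambda>n. x n - c n) ` {N..})"
    \<comment> \<open>The case \<open>m = n\<close> of \<open>incr\<close> gives
      \<open>x n - c n \<le> x n \<le> K\<close>.\<close>
    using incr bound by (intro bdd_aboveI2 [of _ _ K]) (meson atLeast_iff order_refl order_trans)
  have upper: "x n \<le> L + c n" if "N \<le> n" for n
    using cSUP_upper [OF _ bdd, of n] that by (simp add: L_def)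
  have "x \<longlonglongrightarrow> L"
  proof (rule order_tendstoI)
    fix y assume "y < L"
    then obtain m where m: "N \<le> m" "y < x m - c m"
      unfolding L_def using less_cSUP_iff [OF _ bdd] by auto
    then have "y < x n" if "m \<le> n" for n using incr [OF m(1) that] by simp
    then show "\<forall>\<^sub>F n in sequentially. y < x n"
      unfolding eventually_sequentially by blast
  next
    fix y assume "L < y"
    then have "\<forall>\<^sub>F n in sequentially. c n < y - L"
      using order_tendstoD(2) [OF lim, of "y - L"] by simp
    moreover have "\<forall>\<^sub>F n in sequentially. N \<le> n" by (rule eventually_ge_at_top)
    ultimately show "\<forall>\<^sub>F n in sequentially. x n < y"
    proof eventually_elim
      case (elim n)
      then show ?case using upper [of n] by linarith
    qed
  qed
  then show ?thesis by (rule convergentI)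
qed

section \<open>Vertex count, root degree and the two lower bounds\<close>

text \<open>Sending each vertex other than a fixed \<open>r\<close> to the last edge of a shortest path from \<open>r\<close> is
  injective.\<close>

lemma connected_card_gverts_le:
  assumes simple: "simple_graph G" and conn: "connected_graph G"
  shows "card (gverts G) \<le> card (gedges G) + 1"
proof -
  note fin = simple_graph_finite [OF simple]
  let ?R = "{(x, y). {x, y} \<in> gedges G}"
  obtain r where r: "r \<in> gverts G" using conn by (auto simp: connected_graph_def)
  define d where "d v = (LEAST n. (r, v) \<in> ?R ^^ n)" for v
  have "\<exists>u. {u, v} \<in> gedges G \<and> d u < d v" if v: "v \<in> gverts G - {r}" for v
  proof -
    have "(r, v) \<in> ?R\<^sup>*" using conn r v by (auto simp: connected_graph_def)
    then obtain n where "(r, v) \<in> ?R ^^ n" using rtrancl_imp_relpow by blast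
    then have dv: "(r, v) \<in> ?R ^^ d v" unfolding d_def by (rule LeastI)
    then have "d v \<noteq> 0" using v by (metis DiffD2 insertI1 pair_in_Id_conv relpow.simps(1))
    then obtain m where m: "d v = Suc m" using not0_implies_Suc by blast
    then obtain u where u: "(r, u) \<in> ?R ^^ m" "(u, v) \<in> ?R" using dv by auto
    then have "d u \<le> m" unfolding d_def by (intro Least_le)
    then show ?thesis using u(2) m by auto
  qed
  then obtain p where p: "\<And>v. v \<in> gverts G - {r} \<Longrightarrow> {p v, v} \<in> gedges G \<and> d (p v) < d v"
    by metis
  have "inj_on (\<lambda>v. {p v, v}) (gverts G - {r})"
  proof (rule inj_onI)
    fix v w assume v: "v \<in> gverts G - {r}" and w: "w \<in> gverts G - {r}" and eq: "{p v, v} = {p w, w}"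
    show "v = w"
    proof (rule ccontr)
      assume "v \<noteq> w"
      \<comment> \<open>Each vertex would be the predecessor of the other, hence strictly closer to
        \<open>r\<close>.\<close>
      then have "p v = w" "p w = v" using eq by (auto simp: doubleton_eq_iff)
      then show False using p [OF v] p [OF w] by simp
    qed
  qed
  then have "card (gverts G - {r}) \<le> card (gedges G)"
    using p fin(2) by (intro card_inj_on_le) auto
  then show ?thesis using r fin(1) by simp
qed

text \<open>An edge provides a vertex other than \<open>r\<close>, and a walk to it starts with an
  edge at \<open>r\<close>.\<close>

lemma connected_incident_nonempty:
  assumes simple: "simple_graph G" and conn: "connected_graph G" and ne: "gedges G \<noteq> {}"
    and r: "r \<in> gverts G"
  shows "incident G r \<noteq> {}"
proof -
  obtain v where v: "v \<in> gverts G" "v \<noteq> r"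
    using simple ne unfolding simple_graph_def by (metis all_not_in_conv)
  then have "(r, v) \<in> {(x, y). {x, y} \<in> gedges G}\<^sup>*"
    using conn r by (auto simp: connected_graph_def)
  then obtain u where "{r, u} \<in> gedges G"
    using v(2) by (metis (mono_tags, lifting) converse_rtranclE case_prodD mem_Collect_eq)
  then show ?thesis by (auto simp: incident_def)
qed

text \<open>A unit maximizer on the shorter cycle, cut where neighbouring values have a small
  product, is a unit test vector on the longer one.\<close>

lemma (in defect_data) lambda_max_almost_increasing:
  assumes g: "3 \<le> g" and le: "g \<le> h"
  shows "lambda_max (ricci_matrix (single_defect_graph g B r)) - 1 / real (g - 1)
    \<le> lambda_max (ricci_matrix (single_defect_graph h B r))"
proof (cases "g = h")
  case False
  define d where "d = h - g"
  have d: "0 < d" "h = g + d" using le False by (auto simp: d_def)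
  have h: "3 \<le> g + d" using g by simp
  obtain \<beta> a where norm: "defect_norm B g \<beta> a = 1"
    and form: "defect_form B r g \<beta> a = lambda_max (ricci_matrix (single_defect_graph g B r))"
    using lambda_max_defect(2) [OF g] by blast
  have "(\<Sum>i<g. (a i)\<^sup>2) \<le> 1"
    using norm sum_nonneg [of "gedges B" "\<lambda>e. (\<beta> e)\<^sup>2"] by (simp add: defect_norm_def)
  then obtain k where k: "0 < k" "k < g" "a (k - 1) * a k \<le> 1 / real (g - 1)"
    using exists_small_cut [of g a] g by auto
  show ?thesis
    using lambda_max_defect(1) [OF h, of \<beta> "insert_zeros k d a"] k(3)
    by (simp add: defect_insert_zeros [OF k(1,2) d(1)] norm form d(2))
qed simp

text \<open>The value \<open>1\<close> on \<open>B\<close> and the slopes \<open>1/3\<close> along the cycle are such that the gain \<open>\<ge> 4/3\<close> at the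
  root beats the energy \<open>2/3\<close>. Since the sequence vanishes at \<open>6\<close>, zeros can be inserted for free.\<close>

lemma (in defect_data) defect_form_tent_ge:
  assumes conn: "connected_graph B" and ne: "gedges B \<noteq> {}"
  shows "defect_form B r 13 (\<lambda>_. 1) (\<lambda>i. \<bar>6 - real i\<bar> / 3) \<ge> 2 / 3"
proof -
  note fin = simple_graph_finite [OF simple]
  let ?m = "\<lambda>b. real (card (incident B b))"
  \<comment> \<open>The values descend from 2 to 0 at index 6 and rise back to 2 at index 12: twelve
    steps of size \<open>1/3\<close>.\<close>
  have "cycle_energy 13 (\<lambda>i. \<bar>6 - real i\<bar> / 3) = (\<Sum>i=1..<13::nat. 1 / 9 :: real)"
    unfolding cycle_energy_def
  proof (rule sum.cong [OF refl])
    fix i :: nat assume "i \<in> {1..<13}"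
    then have i: "real (i - 1) = real i - 1" by auto
    show "(\<bar>6 - real (i - 1)\<bar> / 3 - \<bar>6 - real i\<bar> / 3)\<^sup>2 = 1 / 9"
    proof (cases "i \<le> 6")
      case True
      then have eq: "\<bar>6 - real (i - 1)\<bar> / 3 - \<bar>6 - real i\<bar> / 3 = 1 / 3" unfolding i by (simp add: field_simps)
      show ?thesis unfolding eq by (simp add: power2_eq_square)
    next
      case False
      then have eq: "\<bar>6 - real (i - 1)\<bar> / 3 - \<bar>6 - real i\<bar> / 3 = - 1 / 3" unfolding i by (simp add: field_simps)
      show ?thesis unfolding eq by (simp add: power2_eq_square)
    qed
  qed
  then have energy: "cycle_energy 13 (\<lambda>i. \<bar>6 - real i\<bar> / 3) = 4 / 3" by simp
  \<comment> \<open>Equality holds at positive degree; at an isolated vertex the form is 0.\<close>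
  have "?m b - 2 \<le> vertex_form B (\<lambda>_. 1) b" for b
    by (cases "?m b = 0") (simp_all add: vertex_form_def field_simps power2_eq_square)
  then have "(\<Sum>b\<in>gverts B - {r}. ?m b - 2) \<le> (\<Sum>b\<in>gverts B - {r}. vertex_form B (\<lambda>_. 1) b)"
    by (intro sum_mono)
  \<comment> \<open>The degrees sum to \<open>2 |E|\<close>, and there are at most
    \<open>|E|\<close> vertices besides \<open>r\<close>.\<close>
  moreover have "(\<Sum>b\<in>gverts B - {r}. ?m b - 2) \<ge> - ?m r"
  proof -
    have "(\<Sum>b\<in>gverts B. ?m b) = 2 * real (card (gedges B))"
      using sum_edges_incident [OF simple, of "\<lambda>_. 1"] by simp
    moreover have "(\<Sum>b\<in>gverts B - {r}. ?m b) = (\<Sum>b\<in>gverts B. ?m b) - ?m r"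
      using fin(1) root by (simp add: sum_diff1)
    moreover have "card (gverts B - {r}) \<le> card (gedges B)"
      using connected_card_gverts_le [OF simple conn] fin(1) root by simp
    ultimately show ?thesis by (simp add: sum_subtractf)
  qed
  \<comment> \<open>After clearing denominators this is exactly \<open>?m r \<ge> 1\<close>.\<close>
  moreover have "((?m r + 2 + 2)\<^sup>2 - 2 * (?m r + 2\<^sup>2 + 2\<^sup>2)) / (?m r + 2) \<ge> ?m r + 4 / 3"
  proof -
    have "?m r \<ge> 1"
      using connected_incident_nonempty [OF simple conn ne root] fin(4) [of r]
      by (simp add: Suc_le_eq card_gt_0_iff)
    then show ?thesis by (simp add: field_simps power2_eq_square)
  qed
  moreover have "defect_form B r 13 (\<lambda>_. 1) (\<lambda>i. \<bar>6 - real i\<bar> / 3)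
      = (\<Sum>b\<in>gverts B - {r}. vertex_form B (\<lambda>_. 1) b)
        + ((?m r + 2 + 2)\<^sup>2 - 2 * (?m r + 2\<^sup>2 + 2\<^sup>2)) / (?m r + 2) - 2 / 3"
    by (simp add: defect_form_def energy)
  ultimately show ?thesis by linarith
qed

theorem lemma5p7:
  fixes B :: "'a sgraph" and r :: 'a
  assumes "rooted_tree B r"
    and "gedges B \<noteq> {}"
  shows "\<exists>L::real. ((\<lambda>g. lambda_max (ricci_matrix (single_defect_graph g B r))) \<longlonglongrightarrow> L) \<and> L > 0"
proof -
  have simple: "simple_graph B" and conn: "connected_graph B" and root: "r \<in> gverts B"
    using assms(1) by (auto simp: rooted_tree_def is_tree_def)
  interpret defect_data B r by standard (fact simple root)+
  define lam where "lam g = lambda_max (ricci_matrix (single_defect_graph g B r))" for g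
  have "(\<lambda>g. 1 / real (g - 1)) \<longlonglongrightarrow> 0"
    by (rule LIMSEQ_imp_Suc) (use lim_inverse_n' in simp)
  then have "convergent lam"
    using lambda_max_defect(3) lambda_max_almost_increasing
    unfolding lam_def by (intro almost_increasing_convergent [where N = 3 and K = 2])
  then obtain L where L: "lam \<longlonglongrightarrow> L" by (auto simp: convergent_def)
  define a where "a i = \<bar>6 - real i\<bar> / 3" for i
  define N where "N = defect_norm B 13 (\<lambda>_. 1) a"
  have "N > 0"
  proof -
    have "(a 0)\<^sup>2 \<le> (\<Sum>i<13. (a i)\<^sup>2)" by (rule member_le_sum) auto
    then show ?thesis by (simp add: N_def defect_norm_def a_def add_nonneg_pos)
  qed
  \<comment> \<open>Cutting at \<open>k = 6\<close> is free since \<open>a 6 = 0\<close>, so form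
    and norm do not depend on \<open>h\<close>; \<open>h \<ge> 14\<close> makes the inserted block
    nonempty.\<close>
  have "2 / 3 / N \<le> lam h" if "h \<ge> 14" for h
  proof -
    define d where "d = h - 13"
    have d: "0 < d" "h = 13 + d" using that by (auto simp: d_def)
    have "3 \<le> 13 + d" by simp
    from lambda_max_defect(1) [OF this, of "\<lambda>_. 1" "insert_zeros 6 d a"]
    have "defect_form B r 13 (\<lambda>_. 1) a \<le> lam h * N"
      using defect_insert_zeros(1) [of 6 13 d B r "\<lambda>_. 1" a]
        defect_insert_zeros(2) [of 6 13 d B "\<lambda>_. 1" a] d
      by (simp add: lam_def N_def) (simp add: a_def)
    then have "2 / 3 \<le> lam h * N"
      using defect_form_tent_ge [OF conn assms(2)] unfolding a_def [abs_def] by linarith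
    then show ?thesis using \<open>N > 0\<close> by (simp add: divide_le_eq)
  qed
  then have "2 / 3 / N \<le> L" by (intro LIMSEQ_le_const [OF L]) blast
  moreover have "0 < 2 / 3 / N" using \<open>N > 0\<close> by simp
  ultimately show ?thesis using L unfolding lam_def by (metis less_le_trans)
qed

end
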